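(* For every orbit $\mathcal{O}_{\rho}$ of $\mathbf{L}$ in $\mathbf{M}^{4}$, the following four cases exhaust the irreducible objects of $\mathbf{Rep(Poinc)}$ lying over $\mathcal{O}_{\rho}$. That is, let $\pi: M \to \mathcal{O}_{\rho}$ be an irreducible object, let $H$ be the stabilizer of a point $m \in M$, and let $G_{\rho}\subseteq \mathbf{L}$ be the stabilizer of $\pi(m) \in \mathcal{O}_{\rho}$ (so $H \subseteq G_{\rho}$). Then at least one of the following holds: 1. (Elementary irrep) $H = G_{\rho}$; 2. (Lie irrep) $H$ is a connected Lie subgroup of $G_{\rho}$; 3. (Crystallographic irrep) $H$ contains a discrete subgroup of $G_{\rho}$; 4. (Non-Hausdorff irrep) $H$ is a non-Lie subgroup of $\mathbf{L}$, so that the total space $M \cong \mathbf{L}/H$ is not Hausdorff.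
   Context: $\mathbf{M}^{4}$ is Minkowski space $\mathbb{R}^{4}$ regarded as an additive group, and $\mathbf{L}$ is the connected Lorentz group $SO(3,1)$ acting linearly on it. $\mathbf{Poinc}$ is the strict $2$-group with one object, $1$-morphisms the elements of $\mathbf{L}$, and $2$-morphisms $g\Rightarrow g$ the elements of $\mathbf{M}^{4}$ (no $2$-morphisms between distinct $g_1,g_2$). $\mathbf{Rep(Poinc)}$ is the $2$-category of $2$-functors from $\mathbf{Poinc}$ to the $2$-category $\mathbf{Meas}$ of categories of measurable fields of Hilbert spaces over measure spaces. Its objects are described by measure spaces $X$ with a measurable action of $\mathbf{L}$ together with an $\mathbf{L}$-equivariant map $X \to \mathbf{M}^{4}$. Any orbit of $\mathbf{L}$ in such an $X$ is a subrepresentation, and the irreducible objects are those consisting of a single orbit: $M \cong \mathbf{L}/H$ with $\mathbf{L}$ acting transitively, together with an equivariant map $\pi$ to $\mathbf{M}^{4}$, whose image is an orbit $\mathcal{O}_{\rho}$ of $\mathbf{L}$ in $\mathbf{M}^{4}$. Thus irreducible objects over $\mathcal{O}_{\rho}$ are the equivariant fiberings $\pi: M \to \mathcal{O}_{\rho}$ with $M$ a single orbit, and they are given by subgroups $H \subseteq G_{\rho}$ of the stabilizer $G_{\rho}$ of a point of $\mathcal{O}_{\rho}$. *)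

theory Defs
  imports "HOL-Analysis.Analysis" "HOL-Algebra.Left_Coset" "HOL-Algebra.Group_Action"
begin

section \<open>The connected Lorentz group acting on Minkowski space\<close>

text \<open>Minkowski space is \<^typ>\<open>real^4\<close>; the time coordinate is the one with index \<open>0\<close>
  (which in the index type \<open>4\<close> is the same as \<open>4\<close>).\<close>

definition minkowski_form :: "real^4^4" where
  "minkowski_form = (\<chi> i j. if i \<noteq> j then 0 else if i = 0 then -1 else 1)"

definition full_lorentz :: "(real^4^4) set" where
  "full_lorentz = {A. transpose A ** minkowski_form ** A = minkowski_form}"

definition Lorentz :: "(real^4^4) monoid" where
  "Lorentz = \<lparr>carrier = connected_component_set full_lorentz (mat 1),
              mult = (**), one = mat 1\<rparr>"

definition mink_action :: "real^4^4 \<Rightarrow> real^4 \<Rightarrow> real^4" where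
  "mink_action A v = A *v v"

lemma minkowski_form_square: "minkowski_form ** minkowski_form = mat 1"
proof -
  have "(\<Sum>k\<in>UNIV. minkowski_form $ i $ k * minkowski_form $ k $ j) = mat 1 $ i $ j" for i j
  proof -
    have "(\<Sum>k\<in>UNIV. minkowski_form $ i $ k * minkowski_form $ k $ j)
        = (\<Sum>k\<in>UNIV. if k = i then minkowski_form $ i $ i * minkowski_form $ i $ j else 0)"
      by (rule sum.cong) (auto simp: minkowski_form_def)
    also have "\<dots> = mat 1 $ i $ j"
      by (auto simp: minkowski_form_def mat_def)
    finally show ?thesis .
  qed
  then show ?thesis
    by (simp add: matrix_matrix_mult_def vec_eq_iff)
qed

lemma full_lorentz_one: "mat 1 \<in> full_lorentz"
  by (simp add: full_lorentz_def transpose_mat)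

lemma full_lorentz_mult:
  assumes "A \<in> full_lorentz" "B \<in> full_lorentz"
  shows "A ** B \<in> full_lorentz"
proof -
  have "transpose (A ** B) ** minkowski_form ** (A ** B)
      = transpose B ** (transpose A ** minkowski_form ** A) ** B"
    by (simp add: matrix_transpose_mul matrix_mul_assoc)
  then show ?thesis using assms by (simp add: full_lorentz_def)
qed

lemma full_lorentz_inverse:
  assumes "A \<in> full_lorentz"
  obtains B where "B \<in> full_lorentz" "B ** A = mat 1" "A ** B = mat 1"
proof -
  define B where "B = minkowski_form ** transpose A ** minkowski_form"
  have A: "transpose A ** minkowski_form ** A = minkowski_form"
    using assms by (simp add: full_lorentz_def)
  have "B ** A = minkowski_form ** (transpose A ** minkowski_form ** A)"
    by (simp add: B_def matrix_mul_assoc)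
  then have BA: "B ** A = mat 1" by (simp add: A minkowski_form_square)
  then have AB: "A ** B = mat 1" using matrix_left_right_inverse by blast
  have "transpose B ** minkowski_form ** B
      = transpose B ** (transpose A ** minkowski_form ** A) ** B"
    by (simp add: A)
  also have "\<dots> = transpose (A ** B) ** minkowski_form ** (A ** B)"
    by (simp add: matrix_transpose_mul matrix_mul_assoc)
  finally have "B \<in> full_lorentz" by (simp add: AB full_lorentz_def transpose_mat)
  with BA AB that show ?thesis by blast
qed

lemma connected_left_translate:
  fixes A :: "real^'n^'n"
  assumes "connected S"
  shows "connected ((**) A ` S)"
proof (rule connected_continuous_image[OF _ assms])
  have "linear ((**) A)"
    by (rule linearI) (simp_all add: matrix_add_ldistrib matrix_scalar_ac scalar_matrix_assoc
        flip: scalar_mult_eq_scaleR)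
  then show "continuous_on S ((**) A)"
    using linear_continuous_on linear_conv_bounded_linear by blast
qed

lemma lorentz_translate_subset:
  assumes A: "A \<in> full_lorentz" and B: "B \<in> carrier Lorentz" "A ** B \<in> carrier Lorentz"
    and C: "C \<in> carrier Lorentz"
  shows "A ** C \<in> carrier Lorentz"
proof -
  let ?L = "connected_component_set full_lorentz (mat 1)"
  have sub: "?L \<subseteq> full_lorentz" by (rule connected_component_subset)
  have "connected ((**) A ` ?L)" by (intro connected_left_translate connected_connected_component)
  moreover have "(**) A ` ?L \<subseteq> full_lorentz" using A sub full_lorentz_mult by blast
  ultimately have "(**) A ` ?L \<subseteq> connected_component_set full_lorentz (A ** B)"
    using B(1) by (intro connected_component_maximal) (auto simp: Lorentz_def)
  also have "\<dots> = ?L"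
    using B(2) by (simp add: Lorentz_def connected_component_eq)
  finally show ?thesis using C by (auto simp: Lorentz_def)
qed

lemma lorentz_subset: "carrier Lorentz \<subseteq> full_lorentz"
  by (simp add: Lorentz_def connected_component_subset)

lemma lorentz_one: "mat 1 \<in> carrier Lorentz"
  by (simp add: Lorentz_def full_lorentz_one)

lemma group_Lorentz: "group Lorentz"
proof (rule groupI)
  fix A B assume A: "A \<in> carrier Lorentz" and B: "B \<in> carrier Lorentz"
  have "A ** B \<in> carrier Lorentz"
    by (rule lorentz_translate_subset[of A "mat 1"])
      (use A B lorentz_subset lorentz_one in auto)
  then show "A \<otimes>\<^bsub>Lorentz\<^esub> B \<in> carrier Lorentz" by (simp add: Lorentz_def)
next
  fix A assume A: "A \<in> carrier Lorentz"
  then obtain B where B: "B \<in> full_lorentz" "B ** A = mat 1"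
    using lorentz_subset full_lorentz_inverse by (metis subsetD)
  have "B ** mat 1 \<in> carrier Lorentz"
    by (rule lorentz_translate_subset[of B A]) (use A B lorentz_one in auto)
  then show "\<exists>B\<in>carrier Lorentz. B \<otimes>\<^bsub>Lorentz\<^esub> A = \<one>\<^bsub>Lorentz\<^esub>"
    using B by (auto simp: Lorentz_def)
qed (use lorentz_one in \<open>auto simp: Lorentz_def matrix_mul_assoc\<close>)

lemma group_action_mink_action: "group_action Lorentz UNIV mink_action"
proof -
  interpret group Lorentz by (rule group_Lorentz)
  have mult: "mink_action (A ** B) = mink_action A \<circ> mink_action B" for A B
    by (auto simp: mink_action_def matrix_vector_mul_assoc)
  have one: "mink_action (mat 1) = id" by (auto simp: mink_action_def)
  have bij: "mink_action A \<in> Bij UNIV" if A: "A \<in> carrier Lorentz" for A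
  proof -
    obtain B where "B ** A = mat 1" "A ** B = mat 1"
      using A lorentz_subset full_lorentz_inverse by (metis subsetD)
    then have "mink_action B \<circ> mink_action A = id" "mink_action A \<circ> mink_action B = id"
      by (metis mult one)+
    then show ?thesis by (simp add: Bij_def o_bij)
  qed
  have "mink_action \<in> hom Lorentz (BijGroup UNIV)"
  proof (rule homI)
    fix A B assume "A \<in> carrier Lorentz" "B \<in> carrier Lorentz"
    then show "mink_action (A \<otimes>\<^bsub>Lorentz\<^esub> B)
        = mink_action A \<otimes>\<^bsub>BijGroup UNIV\<^esub> mink_action B"
      using bij[of A] bij[of B] mult[of A B]
      by (simp add: BijGroup_def Lorentz_def compose_def fun_eq_iff)
  qed (use bij in \<open>simp add: BijGroup_def\<close>)
  then show ?thesis
    by (simp add: group_action_def group_hom_def group_hom_axioms_def group_BijGroup)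
qed

section \<open>Objects of Rep(Poinc)\<close>

text \<open>The action is only required to be by measurable maps. Joint measurability, which implies
  this, would rule out natural \<open>\<sigma>\<close>-algebras on \<open>L/H\<close> for dense subgroups \<open>H\<close>.
  In \<^const>\<open>group_action\<close>, the maps \<open>\<phi> g\<close> are extensional on \<open>space M\<close>.\<close>

definition rep_object ::
  "'x measure \<Rightarrow> (real^4^4 \<Rightarrow> 'x \<Rightarrow> 'x) \<Rightarrow> ('x \<Rightarrow> real^4) \<Rightarrow> bool" where
  "rep_object M \<phi> \<pi> \<longleftrightarrow>
     group_action Lorentz (space M) \<phi> \<and>
     (\<forall>g\<in>carrier Lorentz. \<phi> g \<in> measurable M M) \<and>
     (\<forall>g\<in>carrier Lorentz. \<forall>x\<in>space M. \<pi> (\<phi> g x) = mink_action g (\<pi> x))"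

definition irreducible_object ::
  "'x measure \<Rightarrow> (real^4^4 \<Rightarrow> 'x \<Rightarrow> 'x) \<Rightarrow> ('x \<Rightarrow> real^4) \<Rightarrow> bool" where
  "irreducible_object M \<phi> \<pi> \<longleftrightarrow>
     rep_object M \<phi> \<pi> \<and> orbits Lorentz (space M) \<phi> = {space M}"

section \<open>Lie subgroups\<close>

text \<open>\<open>Ck_on n S f\<close>: \<open>f\<close> is \<open>n\<close> times continuously differentiable on the open set \<open>S\<close>,
  expressed through iterated directional derivatives.\<close>

primrec Ck_on :: "nat \<Rightarrow> 'a::euclidean_space set \<Rightarrow> ('a \<Rightarrow> 'b::euclidean_space) \<Rightarrow> bool" where
  "Ck_on 0 S f \<longleftrightarrow> continuous_on S f"
| "Ck_on (Suc n) S f \<longleftrightarrow>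
     (\<forall>x\<in>S. f differentiable at x) \<and> (\<forall>v. Ck_on n S (\<lambda>x. frechet_derivative f (at x) v))"

definition smooth_on :: "'a::euclidean_space set \<Rightarrow> ('a \<Rightarrow> 'b::euclidean_space) \<Rightarrow> bool" where
  "smooth_on S f \<longleftrightarrow> (\<forall>n. Ck_on n S f)"

definition embedded_submanifold :: "'a::euclidean_space set \<Rightarrow> bool" where
  "embedded_submanifold S \<longleftrightarrow>
     (\<exists>d. \<forall>x\<in>S. \<exists>U V (f :: 'a \<Rightarrow> 'a) g T.
        open U \<and> x \<in> U \<and> open V \<and> homeomorphism U V f g \<and> smooth_on U f \<and> smooth_on V g \<and>
        subspace T \<and> dim T = d \<and> f ` (S \<inter> U) = T \<inter> V)"

text \<open>To be used for matrix groups \<open>G\<close> that are themselves embedded submanifolds of the space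
  of matrices, such as \<open>Lorentz\<close> and its point stabilizers; being embedded in \<open>G\<close> is then the
  same as being embedded in the space of matrices. Lie subgroups are embedded, not merely
  immersed: otherwise every countable subgroup, even a dense one, would be a Lie subgroup and
  have a non-Hausdorff coset space.\<close>

definition lie_subgroup :: "(real^'n^'n) set \<Rightarrow> (real^'n^'n) monoid \<Rightarrow> bool" where
  "lie_subgroup H G \<longleftrightarrow> subgroup H G \<and> embedded_submanifold H"

section \<open>The topology of a coset space\<close>

definition quotient_topology :: "'a topology \<Rightarrow> ('a \<Rightarrow> 'b) \<Rightarrow> 'b topology" where
  "quotient_topology X q =
     topology (\<lambda>U. U \<subseteq> q ` topspace X \<and> openin X {x \<in> topspace X. q x \<in> U})"

lemma openin_quotient_topology:
  "openin (quotient_topology X q) U \<longleftrightarrow>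
     U \<subseteq> q ` topspace X \<and> openin X {x \<in> topspace X. q x \<in> U}"
proof -
  have 1: "{x \<in> topspace X. q x \<in> S \<inter> T}
      = {x \<in> topspace X. q x \<in> S} \<inter> {x \<in> topspace X. q x \<in> T}" for S T by blast
  have 2: "{x \<in> topspace X. q x \<in> \<Union>K} = (\<Union>S\<in>K. {x \<in> topspace X. q x \<in> S})" for K by blast
  have "istopology (\<lambda>U. U \<subseteq> q ` topspace X \<and> openin X {x \<in> topspace X. q x \<in> U})"
    unfolding istopology_def 1 2 by (intro conjI allI impI openin_Int openin_Union) blast+
  then show ?thesis by (simp only: quotient_topology_def topology_inverse')
qed

lemma topspace_quotient_topology: "topspace (quotient_topology X q) = q ` topspace X"
proof (rule antisym)
  show "topspace (quotient_topology X q) \<subseteq> q ` topspace X"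
    using openin_topspace[of "quotient_topology X q"] unfolding openin_quotient_topology ..
  have "{x \<in> topspace X. q x \<in> q ` topspace X} = topspace X" by blast
  then have "openin (quotient_topology X q) (q ` topspace X)"
    unfolding openin_quotient_topology by simp
  then show "q ` topspace X \<subseteq> topspace (quotient_topology X q)" by (rule openin_subset)
qed

lemma quotient_map_quotient_topology: "quotient_map X (quotient_topology X q) q"
  unfolding quotient_map_def topspace_quotient_topology openin_quotient_topology by simp

text \<open>The space \<open>G/H\<close> of left cosets of a matrix group.\<close>

definition coset_topology ::
  "(real^'n^'n) monoid \<Rightarrow> (real^'n^'n) set \<Rightarrow> (real^'n^'n) set topology" where
  "coset_topology G H = quotient_topology (top_of_set (carrier G)) (\<lambda>g. g <#\<^bsub>G\<^esub> H)"

lemma topspace_coset_topology: "topspace (coset_topology G H) = lcosets\<^bsub>G\<^esub> H"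
  unfolding coset_topology_def topspace_quotient_topology LCOSETS_def by auto

end

theory Submission
  imports Defs "HOL-Algebra.Generated_Groups"
begin

text \<open>
  Write \<open>L\<close> for the connected Lorentz group. Whether \<open>H\<close> is closed decides between the cases.

  If \<open>H\<close> is not closed, the fourth case holds. A locally closed subgroup is closed
  (\<open>locally_closed_subgroup_closed\<close>), so \<open>H\<close> is not an embedded submanifold. In a Hausdorff
  coset space the point \<open>H\<close> would be closed, and its preimage in \<open>L\<close> is \<open>H\<close>
  (\<open>Hausdorff_coset_space_closed\<close>).

  If \<open>H\<close> is trivial, it is a connected Lie subgroup of dimension zero.

  If \<open>H\<close> is closed and contains \<open>h \<noteq> 1\<close>, then it contains a nontrivial discrete subgroup
  (\<open>closed_subgroup_contains_discrete\<close>), so the third case holds. Either the cyclic group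
  generated by \<open>h\<close> is discrete, or \<open>h\<close> turns out to be elliptic and the closure of its powers
  contains a half-turn \<open>T\<close>, which generates a subgroup of order two. To find \<open>T\<close>:

    \<^item> If the cyclic group is not discrete, some powers \<open>h\<^sup>n \<noteq> 1\<close> converge to \<open>1\<close>. This recurrence
      forces the whole forward orbit to be bounded (\<open>recurrent_powers_bounded\<close>).

    \<^item> A bounded orbit of the time axis has a compact convex hull inside the forward light cone,
      and Brouwer's theorem gives a fixed timelike vector \<open>v\<close>
      (\<open>bounded_powers_fix_timelike\<close>).

    \<^item> As in the proof of Cartan's closed subgroup theorem, the directions
      \<open>(h\<^sup>n - 1) / \<bar>h\<^sup>n - 1\<bar>\<close> of the powers that tend to \<open>1\<close> accumulate at an \<open>X \<noteq> 0\<close> in the Lie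
      algebra of \<open>L\<close> with \<open>X v = 0\<close>. An infinitesimal Lorentz transformation that kills a timelike
      vector is an infinitesimal rotation: \<open>X\<^sup>3 = - \<omega>\<^sup>2 X\<close> with \<open>\<omega> > 0\<close>
      (\<open>skew_fixing_timelike_cube\<close>).

    \<^item> Hence \<open>J = X / \<omega>\<close> generates the one-parameter group
      \<open>1 + sin t J + (1 - cos t) J\<^sup>2\<close>, all of whose elements with \<open>t \<ge> 0\<close> are limits of powers
      of \<open>h\<close> (\<open>powers_tendsto_rotation_exp\<close>). The half-turn is the one with \<open>t = \<pi>\<close>.
\<close>

section \<open>Matrix multiplication as a bounded bilinear map\<close>

lemma bounded_bilinear_matrix_mult:
  "bounded_bilinear ((**) :: real^'n^'m \<Rightarrow> real^'p^'n \<Rightarrow> real^'p^'m)"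
  unfolding bilinear_conv_bounded_bilinear[symmetric] bilinear_def
  by (auto intro!: linearI simp: matrix_matrix_mult_def vec_eq_iff sum.distrib algebra_simps
      sum_distrib_left)

lemmas matrix_mult_add =
  bounded_bilinear.add_left[OF bounded_bilinear_matrix_mult]
  bounded_bilinear.add_right[OF bounded_bilinear_matrix_mult]
lemmas matrix_mult_diff =
  bounded_bilinear.diff_left[OF bounded_bilinear_matrix_mult]
  bounded_bilinear.diff_right[OF bounded_bilinear_matrix_mult]
lemmas matrix_mult_minus =
  bounded_bilinear.minus_left[OF bounded_bilinear_matrix_mult]
  bounded_bilinear.minus_right[OF bounded_bilinear_matrix_mult]
lemmas matrix_mult_scaleR =
  bounded_bilinear.scaleR_left[OF bounded_bilinear_matrix_mult]
  bounded_bilinear.scaleR_right[OF bounded_bilinear_matrix_mult]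

lemmas continuous_on_matrix_mult [continuous_intros] =
  bounded_bilinear.continuous_on[OF bounded_bilinear_matrix_mult]

lemmas tendsto_matrix_mult [tendsto_intros] =
  bounded_bilinear.tendsto[OF bounded_bilinear_matrix_mult]

lemma continuous_on_transpose [continuous_intros]:
  fixes f :: "'a::topological_space \<Rightarrow> real^'n^'m"
  assumes "continuous_on S f"
  shows "continuous_on S (\<lambda>x. transpose (f x))"
  unfolding transpose_def by (intro continuous_intros assms)

lemma tendsto_transpose [tendsto_intros]:
  fixes f :: "'a \<Rightarrow> real^'n^'m"
  assumes "(f \<longlongrightarrow> l) F"
  shows "((\<lambda>x. transpose (f x)) \<longlongrightarrow> transpose l) F"
  unfolding transpose_def by (intro tendsto_intros assms)

section \<open>The Lorentz group as a closed group of isometries\<close>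

interpretation Lorentz: group Lorentz
  by (rule group_Lorentz)

lemma Lorentz_simps [simp]: "mult Lorentz = (**)" "one Lorentz = mat 1"
  by (simp_all add: Lorentz_def)

text \<open>The adjoint for the Minkowski form. It is the inverse on Lorentz matrices, is defined for all
  matrices, and permutes the entries up to sign, so that inversion preserves the distance to \<open>1\<close>.\<close>

definition lorentz_adjoint :: "real^4^4 \<Rightarrow> real^4^4" where
  "lorentz_adjoint A = minkowski_form ** transpose A ** minkowski_form"

lemma lorentz_adjoint_entry:
  "lorentz_adjoint A $ i $ j = (if (i = 0) = (j = 0) then A $ j $ i else - A $ j $ i)"
proof -
  have *: "(\<Sum>k\<in>UNIV. minkowski_form $ i $ k * f k) = minkowski_form $ i $ i * f i" for f and i :: 4
  proof -
    have "(\<Sum>k\<in>UNIV. minkowski_form $ i $ k * f k)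
        = (\<Sum>k\<in>UNIV. if k = i then minkowski_form $ i $ i * f i else 0)"
      by (rule sum.cong) (auto simp: minkowski_form_def)
    then show ?thesis by simp
  qed
  have **: "(\<Sum>k\<in>UNIV. f k * minkowski_form $ k $ j) = minkowski_form $ j $ j * f j" for f and j :: 4
  proof -
    have "(\<Sum>k\<in>UNIV. f k * minkowski_form $ k $ j)
        = (\<Sum>k\<in>UNIV. if k = j then minkowski_form $ j $ j * f j else 0)"
      by (rule sum.cong) (auto simp: minkowski_form_def)
    then show ?thesis by simp
  qed
  show ?thesis
    by (simp add: lorentz_adjoint_def matrix_matrix_mult_def * **) (simp add: minkowski_form_def transpose_def)
qed

lemma norm_lorentz_adjoint: "norm (lorentz_adjoint A) = norm A"
proof -
  have "(norm (lorentz_adjoint A))\<^sup>2 = (\<Sum>i\<in>UNIV. \<Sum>j\<in>UNIV. (lorentz_adjoint A $ i $ j)\<^sup>2)"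
    by (simp add: norm_vec_def L2_set_def sum_nonneg)
  also have "\<dots> = (\<Sum>i\<in>UNIV. \<Sum>j\<in>UNIV. (A $ j $ i)\<^sup>2)"
    by (intro sum.cong) (auto simp: lorentz_adjoint_entry)
  also have "\<dots> = (norm A)\<^sup>2"
    by (subst sum.swap) (simp add: norm_vec_def L2_set_def sum_nonneg)
  finally show ?thesis by simp
qed

lemma lorentz_adjoint_diff: "lorentz_adjoint (A - B) = lorentz_adjoint A - lorentz_adjoint B"
  by (simp add: vec_eq_iff lorentz_adjoint_entry)

lemma lorentz_adjoint_one [simp]: "lorentz_adjoint (mat 1) = mat 1"
  by (simp add: vec_eq_iff lorentz_adjoint_entry mat_def)

lemma lorentz_adjoint_mult: "lorentz_adjoint (A ** B) = lorentz_adjoint B ** lorentz_adjoint A"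
proof -
  have "lorentz_adjoint B ** lorentz_adjoint A = minkowski_form ** transpose B **
      (minkowski_form ** minkowski_form) ** transpose A ** minkowski_form"
    by (simp only: lorentz_adjoint_def matrix_mul_assoc)
  then show ?thesis
    by (simp add: lorentz_adjoint_def matrix_transpose_mul matrix_mul_assoc minkowski_form_square)
qed

lemma lorentz_adjoint_adjoint [simp]: "lorentz_adjoint (lorentz_adjoint A) = A"
  by (simp add: vec_eq_iff lorentz_adjoint_entry)

lemma norm_lorentz_adjoint_minus_one: "norm (lorentz_adjoint A - mat 1) = norm (A - mat 1)"
  using norm_lorentz_adjoint[of "A - mat 1"] by (simp add: lorentz_adjoint_diff)

lemma full_lorentz_adjoint:
  assumes "A \<in> full_lorentz"
  shows "lorentz_adjoint A ** A = mat 1" "A ** lorentz_adjoint A = mat 1"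
proof -
  have "lorentz_adjoint A ** A = minkowski_form ** (transpose A ** minkowski_form ** A)"
    by (simp add: lorentz_adjoint_def matrix_mul_assoc)
  then show "lorentz_adjoint A ** A = mat 1"
    using assms by (simp add: full_lorentz_def minkowski_form_square)
  then show "A ** lorentz_adjoint A = mat 1" by (rule matrix_left_right_inverse1)
qed

lemma inv_Lorentz:
  assumes "A \<in> carrier Lorentz"
  shows "inv\<^bsub>Lorentz\<^esub> A = lorentz_adjoint A"
proof -
  have "inv\<^bsub>Lorentz\<^esub> A ** A = mat 1" using assms Lorentz.l_inv by simp
  moreover have "A ** lorentz_adjoint A = mat 1" using assms full_lorentz_adjoint lorentz_subset by blast
  ultimately show ?thesis by (metis matrix_mul_assoc matrix_mul_lid matrix_mul_rid)
qed

lemma closed_Lorentz: "closed (carrier Lorentz)"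
proof -
  have "closed full_lorentz" unfolding full_lorentz_def
    by (intro closed_Collect_eq continuous_intros)
  then show ?thesis by (simp add: Lorentz_def closed_connected_component)
qed

text \<open>The unit vector of the time axis has Minkowski square \<open>- 1\<close>, and so has its image.\<close>

lemma full_lorentz_time_column:
  assumes "A \<in> full_lorentz"
  shows "(A $ 0 $ 0)\<^sup>2 = 1 + (A $ 1 $ 0)\<^sup>2 + (A $ 2 $ 0)\<^sup>2 + (A $ 3 $ 0)\<^sup>2"
proof -
  have "(lorentz_adjoint A ** A) $ 0 $ 0 = 1"
    using full_lorentz_adjoint[OF assms] by (simp add: mat_def)
  moreover have "(4::4) = 0" by simp
  ultimately show ?thesis
    by (simp add: matrix_matrix_mult_def sum_4 lorentz_adjoint_entry power2_eq_square)
qed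

text \<open>The time component has absolute value at least \<open>1\<close> on the full Lorentz group, so it cannot change
  sign on the connected component of \<open>1\<close>.\<close>

lemma Lorentz_orthochronous:
  assumes "A \<in> carrier Lorentz"
  shows "A $ 0 $ 0 \<ge> 1"
proof (rule ccontr)
  assume "\<not> A $ 0 $ 0 \<ge> 1"
  let ?T = "(\<lambda>A. A $ 0 $ 0) ` carrier Lorentz"
  have "connected ?T"
    by (intro connected_continuous_image continuous_intros) (simp add: Lorentz_def)
  then have "0 \<in> ?T"
  proof (rule connectedD_interval[of _ "A $ 0 $ 0" 1])
    show "1 \<in> ?T" using lorentz_one by (force simp: mat_def)
    have "(A $ 0 $ 0)\<^sup>2 \<ge> 1"
      using full_lorentz_time_column[of A] assms lorentz_subset by auto
    then have "1 \<le> \<bar>A $ 0 $ 0\<bar>" by (simp add: abs_square_less_1 flip: not_less)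
    with \<open>\<not> A $ 0 $ 0 \<ge> 1\<close> show "A $ 0 $ 0 \<le> 0" by linarith
  qed (use assms in auto)
  then obtain B where "B \<in> carrier Lorentz" "B $ 0 $ 0 = 0" by auto
  then have B: "0 = 1 + (B $ 1 $ 0)\<^sup>2 + (B $ 2 $ 0)\<^sup>2 + (B $ 3 $ 0)\<^sup>2"
    using full_lorentz_time_column[of B] lorentz_subset by auto
  have "0 \<le> (B $ 1 $ 0)\<^sup>2 + (B $ 2 $ 0)\<^sup>2 + (B $ 3 $ 0)\<^sup>2" by simp
  with B show False by linarith
qed

section \<open>Recurrent cyclic subgroups are bounded\<close>

text \<open>Left translations carry a gap around \<open>1\<close> to a gap around any other element.\<close>

lemma discrete_subgroupI:
  assumes K: "subgroup K Lorentz" and "\<delta> > 0"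
    and gap: "\<And>g. g \<in> K \<Longrightarrow> norm (g - mat 1) < \<delta> \<Longrightarrow> g = mat 1"
  shows "discrete K"
proof (rule discreteI)
  fix x assume x: "x \<in> K"
  then have xL: "x \<in> carrier Lorentz" using K subgroup.mem_carrier by metis
  then have inv: "lorentz_adjoint x ** x = mat 1" "x ** lorentz_adjoint x = mat 1"
    using full_lorentz_adjoint lorentz_subset by blast+
  define W where "W = {y. norm (lorentz_adjoint x ** y - mat 1) < \<delta>}"
  have "open W" unfolding W_def by (intro open_Collect_less continuous_intros)
  moreover have "W \<inter> K = {x}"
  proof (intro equalityI subsetI)
    fix y assume y: "y \<in> W \<inter> K"
    have "lorentz_adjoint x \<in> K" using K x xL inv_Lorentz subgroup.m_inv_closed by metis
    then have "lorentz_adjoint x ** y \<in> K"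
      using subgroup.m_closed[OF K, of "lorentz_adjoint x" y] y by simp
    with gap[of "lorentz_adjoint x ** y"] y have "lorentz_adjoint x ** y = mat 1"
      by (simp add: W_def)
    then have "y = x" by (metis inv(2) matrix_mul_assoc matrix_mul_lid matrix_mul_rid)
    then show "y \<in> {x}" by simp
  qed (use x \<open>\<delta> > 0\<close> inv in \<open>auto simp: W_def\<close>)
  ultimately show "x isolated_in K" using x by (intro isolated_inI)
qed

text \<open>A cyclic group is discrete if there is a gap between \<open>1\<close> and the powers that differ from \<open>1\<close>.
  Finitely many powers always leave such a gap, and \<open>h\<^sup>-\<^sup>n\<close> is as far from \<open>1\<close> as \<open>h\<^sup>n\<close>. Hence
  nondiscreteness shows in arbitrarily large positive exponents.\<close>

lemma nondiscrete_cyclic_recurrent: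
  fixes \<delta> :: real and N :: nat
  assumes h: "h \<in> carrier Lorentz" and nd: "\<not> discrete (generate Lorentz {h})" and "\<delta> > 0"
  obtains n where "n \<ge> N" "h [^]\<^bsub>Lorentz\<^esub> n \<noteq> mat 1" "norm (h [^]\<^bsub>Lorentz\<^esub> n - mat 1) < \<delta>"
proof -
  have "\<exists>n\<ge>N. h [^]\<^bsub>Lorentz\<^esub> n \<noteq> mat 1 \<and> norm (h [^]\<^bsub>Lorentz\<^esub> n - mat 1) < \<delta>"
  proof (rule ccontr)
    assume "\<not> ?thesis"
    then have far: "h [^]\<^bsub>Lorentz\<^esub> n = mat 1 \<or> norm (h [^]\<^bsub>Lorentz\<^esub> n - mat 1) \<ge> \<delta>"
      if "n \<ge> N" for n using that by force
    define F where "F = insert \<delta> {norm (h [^]\<^bsub>Lorentz\<^esub> n - mat 1) | n. n < N \<and> h [^]\<^bsub>Lorentz\<^esub> n \<noteq> mat 1}"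
    have F: "finite F" "F \<noteq> {}" by (auto simp: F_def)
    have pos: "Min F > 0" using F \<open>\<delta> > 0\<close> by (auto simp: F_def)
    have nat_gap: "h [^]\<^bsub>Lorentz\<^esub> n = mat 1" if "norm (h [^]\<^bsub>Lorentz\<^esub> n - mat 1) < Min F" for n :: nat
    proof (rule ccontr)
      assume ne: "h [^]\<^bsub>Lorentz\<^esub> n \<noteq> mat 1"
      show False
      proof (cases "n < N")
        case True
        then have "norm (h [^]\<^bsub>Lorentz\<^esub> n - mat 1) \<in> F" using ne by (auto simp: F_def)
        then show False using that F by (meson Min_le not_less)
      next
        case False
        then have "\<delta> \<le> norm (h [^]\<^bsub>Lorentz\<^esub> n - mat 1)" using far[of n] ne by auto
        moreover have "Min F \<le> \<delta>" using F by (simp add: F_def)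
        ultimately show False using that by linarith
      qed
    qed
    have "discrete (generate Lorentz {h})"
    proof (rule discrete_subgroupI[OF _ pos])
      show "subgroup (generate Lorentz {h}) Lorentz"
        using h by (intro Lorentz.generate_is_subgroup) auto
      fix g assume "g \<in> generate Lorentz {h}" and g: "norm (g - mat 1) < Min F"
      then obtain k :: int where k: "g = h [^]\<^bsub>Lorentz\<^esub> k"
        using Lorentz.generate_pow[OF h] by auto
      show "g = mat 1"
      proof (cases "k < 0")
        case True
        then have eq: "g = lorentz_adjoint (h [^]\<^bsub>Lorentz\<^esub> nat (- k))"
          using inv_Lorentz[of "h [^]\<^bsub>Lorentz\<^esub> nat (- k)"] h k int_pow_def2[of Lorentz h k] by auto
        then have "h [^]\<^bsub>Lorentz\<^esub> nat (- k) = mat 1"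
          using nat_gap g by (simp add: norm_lorentz_adjoint_minus_one)
        then show ?thesis using eq by simp
      next
        case False
        then have "g = h [^]\<^bsub>Lorentz\<^esub> nat k" unfolding k int_pow_def2 by (rule if_not_P)
        then show ?thesis using nat_gap g by blast
      qed
    qed
    with nd show False ..
  qed
  then show ?thesis using that by blast
qed

text \<open>This is the argument that a cyclic subgroup of a locally compact group is discrete or relatively
  compact. Call an exponent \<open>i\<close> good if \<open>h\<^sup>i\<close> lies in a fixed compact ball. By compactness there is
  an \<open>N\<close> such that from any good \<open>i \<ge> N\<close> some step down by at most \<open>N\<close> leads to a good exponent again.
  Recurrence gives good exponents above any \<open>m\<close>; the least of them is less than \<open>m + N\<close>. So every
  power differs from one in the ball by one of finitely many factors.\<close>

lemma recurrent_powers_bounded: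
  assumes h: "h \<in> carrier Lorentz"
    and rec: "\<And>\<delta> N::nat. \<delta> > 0 \<Longrightarrow> \<exists>n\<ge>N. norm (h [^]\<^bsub>Lorentz\<^esub> n - mat 1) < \<delta>"
  shows "bounded (range (\<lambda>n::nat. h [^]\<^bsub>Lorentz\<^esub> n))"
proof -
  define P where "P n = h [^]\<^bsub>Lorentz\<^esub> (n::nat)" for n
  \<comment> \<open>The ball must contain a neighbourhood of \<open>1\<close>.\<close>
  define R where "R = norm (mat 1 :: real^4^4) + 1"
  define D where "D = closure (range P) \<inter> cball 0 R"
  define U :: "nat \<Rightarrow> (real^4^4) set" where "U n = {g. norm (lorentz_adjoint (P n) ** g) < R}" for n
  have P: "P n \<in> carrier Lorentz" for n using h by (simp add: P_def)
  have Padd: "P i ** P j = P (i + j)" for i j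
    using Lorentz.nat_pow_mult[OF h, of i j] by (simp add: P_def)
  have inv: "lorentz_adjoint g ** g = mat 1" "g ** lorentz_adjoint g = mat 1"
    if "g \<in> carrier Lorentz" for g
    using full_lorentz_adjoint[of g] subsetD[OF lorentz_subset that] by simp_all
  have Psub: "lorentz_adjoint (P n) ** P i = P (i - n)" if "n \<le> i" for n i
  proof -
    have "lorentz_adjoint (P n) ** P i = lorentz_adjoint (P n) ** P n ** P (i - n)"
      using Padd[of n "i - n"] that by (simp flip: matrix_mul_assoc)
    then show ?thesis by (simp add: inv P)
  qed
  have "compact D" unfolding D_def by (simp add: closed_Int_compact)
  moreover have "open (U n)" for n
    unfolding U_def by (intro open_Collect_less continuous_intros)
  moreover have "D \<subseteq> (\<Union>n\<in>{1..}. U n)"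
  proof
    fix g assume "g \<in> D"
    then have gcl: "g \<in> closure (range P)" by (simp add: D_def)
    have "closure (range P) \<subseteq> carrier Lorentz" using P by (intro closure_minimal closed_Lorentz) auto
    with gcl have gL: "g \<in> carrier Lorentz" by blast
    \<comment> \<open>Some power \<open>h\<^sup>j\<close> is close to \<open>g\<close>; recurrence makes the exponent positive.\<close>
    define W where "W = {q. norm (lorentz_adjoint g ** q - mat 1) < 1}"
    have oW: "open W" unfolding W_def by (intro open_Collect_less continuous_intros)
    have "g \<in> W" using gL by (simp add: W_def inv)
    then have "W \<inter> range P \<noteq> {}" using gcl open_Int_closure_eq_empty[OF oW, of "range P"] by blast
    then obtain j where j: "P j \<in> W" by blast
    have "open {q. P j ** q \<in> W}"
      using open_vimage[OF oW, of "\<lambda>q. P j ** q"] by (simp add: vimage_def continuous_intros)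
    moreover have "mat 1 \<in> {q. P j ** q \<in> W}" using j by simp
    ultimately obtain \<delta> where "\<delta> > 0" and \<delta>: "ball (mat 1) \<delta> \<subseteq> {q. P j ** q \<in> W}"
      using open_contains_ball by blast
    obtain M where "M \<ge> 1" "norm (P M - mat 1) < \<delta>" using rec[OF \<open>\<delta> > 0\<close>, of 1] by (auto simp: P_def)
    then have "P M \<in> ball (mat 1) \<delta>" by (simp add: dist_norm norm_minus_commute)
    with \<delta> have "P (j + M) \<in> W" by (auto simp: Padd)
    then have "norm (lorentz_adjoint (lorentz_adjoint g ** P (j + M)) - mat 1) < 1"
      by (simp add: W_def norm_lorentz_adjoint_minus_one)
    then have "norm (lorentz_adjoint (P (j + M)) ** g - mat 1) < 1"
      by (simp add: lorentz_adjoint_mult)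
    then have "g \<in> U (j + M)" unfolding U_def R_def
      using norm_triangle_sub[of "lorentz_adjoint (P (j + M)) ** g" "mat 1"] by simp
    then show "g \<in> (\<Union>n\<in>{1..}. U n)" using \<open>M \<ge> 1\<close> by fastforce
  qed
  ultimately obtain C where C: "C \<subseteq> {1..}" "finite C" "D \<subseteq> (\<Union>n\<in>C. U n)"
    using compactE_image[of D "{1..}" U] by metis
  from C(2) obtain N where N: "\<And>n. n \<in> C \<Longrightarrow> n \<le> N" unfolding finite_nat_set_iff_bounded_le by auto
  obtain b where b: "\<And>j. j \<le> N \<Longrightarrow> norm (P j) \<le> b"
  proof
    show "norm (P j) \<le> Max ((\<lambda>j. norm (P j)) ` {..N})" if "j \<le> N" for j
      using that by (intro Max_ge) auto
  qed
  obtain c where "c > 0" and c: "\<And>(A::real^4^4) (B::real^4^4). norm (A ** B) \<le> norm A * norm B * c"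
    using bounded_bilinear.pos_bounded[OF bounded_bilinear_matrix_mult] by metis
  have "norm (P m) \<le> b * R * c" for m
  proof -
    obtain n where n: "n \<ge> m" "norm (P n - mat 1) < 1" using rec[of 1 m] by (auto simp: P_def)
    then have "norm (P n) \<le> R" using norm_triangle_sub[of "P n" "mat 1"] by (simp add: R_def)
    define i where "i = (LEAST i. m \<le> i \<and> norm (P i) \<le> R)"
    have i: "m \<le> i \<and> norm (P i) \<le> R" unfolding i_def
      by (rule LeastI[of _ n]) (use n \<open>norm (P n) \<le> R\<close> in auto)
    have "i < m + N"
    proof (rule ccontr)
      assume "\<not> i < m + N"
      have "P i \<in> D" using i closure_subset[of "range P"] by (auto simp: D_def)
      then obtain n where nC: "n \<in> C" "P i \<in> U n" using C by blast
      then have n: "1 \<le> n" "n \<le> N" using C N by auto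
      then have "norm (P (i - n)) \<le> R" using nC \<open>\<not> i < m + N\<close> by (simp add: U_def Psub)
      moreover have "i - n < i" "m \<le> i - n" using n \<open>\<not> i < m + N\<close> by auto
      ultimately show False using not_less_Least[of "i - n"] unfolding i_def by blast
    qed
    have "P m = lorentz_adjoint (P (i - m)) ** P i" using i by (simp add: Psub)
    then have "norm (P m) \<le> norm (P (i - m)) * norm (P i) * c"
      using c[of "lorentz_adjoint (P (i - m))" "P i"] by (simp add: norm_lorentz_adjoint)
    also have "\<dots> \<le> b * R * c"
    proof (intro mult_right_mono mult_mono)
      show Pb: "norm (P (i - m)) \<le> b" using b \<open>i < m + N\<close> by simp
      show "0 \<le> b" using Pb norm_ge_zero order_trans by blast
    qed (use i \<open>c > 0\<close> in auto)
    finally show ?thesis .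
  qed
  then have "bounded (range P)" by (auto intro: boundedI)
  then show ?thesis by (simp add: P_def)
qed

section \<open>Bounded cyclic subgroups fix a timelike vector\<close>

text \<open>The vectors with \<open>v\<^sub>0 \<ge> sqrt (1 + v\<^sub>1\<^sup>2 + v\<^sub>2\<^sup>2 + v\<^sub>3\<^sup>2)\<close> form a closed convex set \<open>W\<close> of timelike vectors,
  bounded by the hyperboloid that contains the orbit of the time axis. The convex hull of the
  orbit closure is a compact subset of \<open>W\<close> that \<open>h\<close> maps into itself.\<close>

lemma bounded_powers_fix_timelike:
  assumes h: "h \<in> carrier Lorentz" and bdd: "bounded (range (\<lambda>n::nat. h [^]\<^bsub>Lorentz\<^esub> n))"
  obtains v where "h *v v = v" "(v $ 1)\<^sup>2 + (v $ 2)\<^sup>2 + (v $ 3)\<^sup>2 < (v $ 0)\<^sup>2"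
proof -
  define P where "P n = h [^]\<^bsub>Lorentz\<^esub> (n::nat)" for n
  define e where "e = (axis 0 1 :: real^4)"
  define T where "T = closure (range (\<lambda>n. P n *v e))"
  \<comment> \<open>Replacing the time component by \<open>1\<close> makes the square root above a norm.\<close>
  define s :: "real^4 \<Rightarrow> real^4" where "s v = (\<chi> i. if i = 0 then 1 else v $ i)" for v
  define W where "W = {v. norm (s v) \<le> v $ 0}"
  have P: "P n \<in> carrier Lorentz" for n using h by (simp add: P_def)
  have norm_s: "(norm (s v))\<^sup>2 = 1 + (v $ 1)\<^sup>2 + (v $ 2)\<^sup>2 + (v $ 3)\<^sup>2" for v
    by (simp add: norm_vec_def L2_set_def sum_4 s_def)
  have "bounded_linear (\<lambda>A. A *v e)"
    unfolding linear_conv_bounded_linear[symmetric]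
    by (intro linearI) (simp_all add: matrix_vector_mult_add_rdistrib scaleR_matrix_vector_assoc)
  from bounded_linear_image[OF bdd this] have "bounded (range (\<lambda>n. P n *v e))"
    by (simp add: P_def image_image)
  then have "compact T" by (simp add: T_def compact_closure)
  have "continuous_on UNIV (\<lambda>v :: real^4. if i = 0 then 1 else v $ i)" for i
    by (cases "i = 0") (auto intro!: continuous_intros)
  then have "closed W" unfolding W_def s_def
    by (intro closed_Collect_le continuous_on_norm continuous_on_vec_lambda)
      (auto intro: continuous_intros)
  have "convex W"
  proof (rule convexI)
    fix x y :: "real^4" and u w :: real
    assume x: "x \<in> W" and y: "y \<in> W" and uw: "0 \<le> u" "0 \<le> w" "u + w = 1"
    have "s (u *\<^sub>R x + w *\<^sub>R y) = u *\<^sub>R s x + w *\<^sub>R s y"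
      using uw by (simp add: s_def vec_eq_iff)
    then have "norm (s (u *\<^sub>R x + w *\<^sub>R y)) \<le> u * norm (s x) + w * norm (s y)"
      using norm_triangle_ineq[of "u *\<^sub>R s x" "w *\<^sub>R s y"] uw by simp
    also have "\<dots> \<le> u * x $ 0 + w * y $ 0"
      using x y uw by (intro add_mono mult_left_mono) (auto simp: W_def)
    finally show "u *\<^sub>R x + w *\<^sub>R y \<in> W" by (simp add: W_def)
  qed
  have PW: "P n *v e \<in> W" for n
  proof -
    have col: "(P n *v e) $ i = P n $ i $ 0" for i
      by (simp add: e_def matrix_vector_mult_basis column_def)
    have "(norm (s (P n *v e)))\<^sup>2 = (P n $ 0 $ 0)\<^sup>2"
      using full_lorentz_time_column[of "P n"] P[of n] lorentz_subset by (auto simp: norm_s col)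
    then have "norm (s (P n *v e)) = P n $ 0 $ 0"
      using Lorentz_orthochronous[OF P[of n]] by (simp add: power2_eq_iff_nonneg)
    then show ?thesis by (simp add: W_def col)
  qed
  have "T \<subseteq> W" unfolding T_def using PW \<open>closed W\<close> by (intro closure_minimal) auto
  have PSuc: "h *v (P n *v e) = P (Suc n) *v e" for n
    using Lorentz.nat_pow_Suc2[OF h, of n] by (simp add: P_def matrix_vector_mul_assoc)
  have "(*v) h ` T \<subseteq> T"
  proof -
    have "(*v) h ` T \<subseteq> closure ((*v) h ` range (\<lambda>n. P n *v e))"
      unfolding T_def by (intro closure_linear_image_subset) simp
    also have "\<dots> \<subseteq> T" unfolding T_def by (rule closure_mono) (auto simp: PSuc)
    finally show ?thesis .
  qed
  obtain v where v: "v \<in> convex hull T" "h *v v = v"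
  proof (rule brouwer[of "convex hull T" "(*v) h"])
    show "compact (convex hull T)" using \<open>compact T\<close> by (rule compact_convex_hull)
    show "convex hull T \<noteq> {}" by (simp add: T_def)
    have "(*v) h ` (convex hull T) = convex hull ((*v) h ` T)"
      by (intro convex_hull_linear_image) simp
    also have "\<dots> \<subseteq> convex hull T" using \<open>(*v) h ` T \<subseteq> T\<close> by (rule hull_mono)
    finally show "(*v) h \<in> convex hull T \<rightarrow> convex hull T" by blast
  qed (auto intro: continuous_intros)
  have "convex hull T \<subseteq> W" using \<open>T \<subseteq> W\<close> \<open>convex W\<close> by (rule hull_minimal)
  then have "norm (s v) \<le> v $ 0" using v by (auto simp: W_def)
  then have "(norm (s v))\<^sup>2 \<le> (v $ 0)\<^sup>2" by (intro power_mono) auto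
  then have "(v $ 1)\<^sup>2 + (v $ 2)\<^sup>2 + (v $ 3)\<^sup>2 < (v $ 0)\<^sup>2" by (simp add: norm_s)
  with v show ?thesis using that by blast
qed

section \<open>One-parameter groups of rotations\<close>

text \<open>The entries of \<open>X\<close> are those of an electromagnetic field, with electric part
  \<open>E = (a, b, c)\<close> and magnetic part \<open>B = (p, q, r)\<close>, and \<open>X v = 0\<close> says that an observer moving
  along \<open>v\<close> sees no electric field: \<open>t E = B \<times> u\<close> for \<open>v = (t, u)\<close>. Hence \<open>E \<bullet> B = 0\<close> and,
  since \<open>\<bar>u\<bar> < \<bar>t\<bar>\<close> and \<open>X \<noteq> 0\<close>, the invariant \<open>\<omega>\<^sup>2 = \<bar>B\<bar>\<^sup>2 - \<bar>E\<bar>\<^sup>2\<close> is positive. By Cayley-Hamilton,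
  \<open>X\<^sup>4 + \<omega>\<^sup>2 X\<^sup>2 - (E \<bullet> B)\<^sup>2 = 0\<close>, and for \<open>E \<bullet> B = 0\<close> the cubic relation holds already.\<close>

lemma skew_fixing_timelike_cube:
  fixes X :: "real^4^4" and v :: "real^4"
  assumes skew: "lorentz_adjoint X = - X" and Xv: "X *v v = 0" and "X \<noteq> 0"
    and timelike: "(v $ 1)\<^sup>2 + (v $ 2)\<^sup>2 + (v $ 3)\<^sup>2 < (v $ 0)\<^sup>2"
  obtains \<omega> where "\<omega> > 0" "X ** X ** X = - (\<omega>\<^sup>2) *\<^sub>R X"
proof -
  define a b c p q r where X_defs: "a = X $ 1 $ 0" "b = X $ 2 $ 0" "c = X $ 3 $ 0"
    "p = X $ 2 $ 3" "q = X $ 3 $ 1" "r = X $ 1 $ 2"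
  define w where "w = p\<^sup>2 + q\<^sup>2 + r\<^sup>2 - (a\<^sup>2 + b\<^sup>2 + c\<^sup>2)"
  \<comment> \<open>The time index \<open>0\<close> is written \<open>4\<close> in the sums over the four indices.\<close>
  have four: "(4::4) = 0" by simp
  have sk: "(if (i = 0) = (j = 0) then X $ j $ i else - X $ j $ i) = - X $ i $ j" for i j
    using arg_cong[OF skew, of "\<lambda>A. A $ i $ j"] by (simp add: lorentz_adjoint_entry)
  have X: "X $ 0 $ 0 = 0" "X $ 1 $ 1 = 0" "X $ 2 $ 2 = 0" "X $ 3 $ 3 = 0"
    "X $ 1 $ 0 = a" "X $ 2 $ 0 = b" "X $ 3 $ 0 = c"
    "X $ 0 $ 1 = a" "X $ 0 $ 2 = b" "X $ 0 $ 3 = c"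
    "X $ 2 $ 3 = p" "X $ 3 $ 2 = - p" "X $ 3 $ 1 = q" "X $ 1 $ 3 = - q" "X $ 1 $ 2 = r" "X $ 2 $ 1 = - r"
    using sk[of 0 0] sk[of 1 1] sk[of 2 2] sk[of 3 3] sk[of 0 1] sk[of 0 2] sk[of 0 3]
      sk[of 2 3] sk[of 3 1] sk[of 1 2]
    by (simp_all add: X_defs)
  have Xv': "(X *v v) $ i = 0" for i using Xv by simp
  define t x y z where v_defs: "t = v $ 0" "x = v $ 1" "y = v $ 2" "z = v $ 3"
  have eqs: "a * t + r * y - q * z = 0" "b * t - r * x + p * z = 0" "c * t + q * x - p * y = 0"
    using Xv'[of 1] Xv'[of 2] Xv'[of 3]
    by (simp_all add: matrix_vector_mult_def sum_4 four X v_defs)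
  have tl: "x\<^sup>2 + y\<^sup>2 + z\<^sup>2 < t\<^sup>2" using timelike by (simp add: v_defs)
  then have t0: "t \<noteq> 0" by (smt (verit) power_zero_numeral zero_le_power2)
  have at: "a * t = q * z - r * y" "b * t = r * x - p * z" "c * t = p * y - q * x"
    using eqs by linarith+
  have "(a * p + b * q + c * r) * t = (a * t) * p + (b * t) * q + (c * t) * r" by algebra
  also have "\<dots> = 0" unfolding at by algebra
  finally have eb: "a * p + b * q + c * r = 0" using t0 by simp
  have "w > 0"
  proof (cases "p\<^sup>2 + q\<^sup>2 + r\<^sup>2 = 0")
    case True
    then have pqr: "p = 0" "q = 0" "r = 0"
      by (smt (verit) zero_le_power2 power2_eq_iff_nonneg power_zero_numeral zero_eq_power2)+
    then have "a = 0" "b = 0" "c = 0" using at t0 by auto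
    then have "X = 0" using X pqr by (simp add: vec_eq_iff forall_4 four)
    with \<open>X \<noteq> 0\<close> show ?thesis ..
  next
    case False
    then have pos: "p\<^sup>2 + q\<^sup>2 + r\<^sup>2 > 0" by (smt (verit) zero_le_power2)
    have "(a\<^sup>2 + b\<^sup>2 + c\<^sup>2) * t\<^sup>2 = (a * t)\<^sup>2 + (b * t)\<^sup>2 + (c * t)\<^sup>2" by algebra
    \<comment> \<open>Lagrange's identity for \<open>\<bar>B \<times> u\<bar>\<^sup>2\<close>.\<close>
    also have "\<dots> = (x\<^sup>2 + y\<^sup>2 + z\<^sup>2) * (p\<^sup>2 + q\<^sup>2 + r\<^sup>2) - (x * p + y * q + z * r)\<^sup>2"
      unfolding at by algebra
    also have "\<dots> \<le> (x\<^sup>2 + y\<^sup>2 + z\<^sup>2) * (p\<^sup>2 + q\<^sup>2 + r\<^sup>2)" by simp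
    also have "\<dots> < t\<^sup>2 * (p\<^sup>2 + q\<^sup>2 + r\<^sup>2)" using tl pos by (rule mult_strict_right_mono)
    finally show ?thesis using t0 by (simp add: w_def mult.commute[of _ "t\<^sup>2"])
  qed
  have cube: "X ** X ** X = - w *\<^sub>R X"
    unfolding vec_eq_iff forall_4 four
    by (simp add: matrix_matrix_mult_def sum_4 four X w_def, intro conjI)
      (algebra | (use eb in algebra))+
  show ?thesis
    by (rule that[of "sqrt w"]) (use \<open>w > 0\<close> cube in auto)
qed

text \<open>For \<open>J\<^sup>3 = - J\<close> this is the exponential of \<open>t J\<close>: the powers of \<open>J\<close> are then, up to sign, \<open>J\<close> and
  \<open>J\<^sup>2\<close>, and the exponential series splits into the sine and cosine series (Rodrigues' formula).\<close>

definition rotation_exp :: "real^'n^'n \<Rightarrow> real \<Rightarrow> real^'n^'n" where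
  "rotation_exp J t = mat 1 + sin t *\<^sub>R J + (1 - cos t) *\<^sub>R (J ** J)"

lemma rotation_exp_add:
  assumes J: "J ** J ** J = - J"
  shows "rotation_exp J s ** rotation_exp J t = rotation_exp J (s + t)"
proof -
  have J3: "J ** (J ** J) = - J" using J by (simp add: matrix_mul_assoc)
  then have J4: "J ** J ** (J ** J) = - (J ** J)"
    by (simp add: matrix_mult_minus flip: matrix_mul_assoc)
  have "rotation_exp J s ** rotation_exp J t
      = mat 1 + (sin s + sin t - sin s * (1 - cos t) - (1 - cos s) * sin t) *\<^sub>R J
        + ((1 - cos s) + (1 - cos t) + sin s * sin t - (1 - cos s) * (1 - cos t)) *\<^sub>R (J ** J)"
    by (simp add: rotation_exp_def matrix_mult_add matrix_mult_diff matrix_mult_scaleR J J3 J4 algebra_simps)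
  also have "\<dots> = rotation_exp J (s + t)"
    by (simp add: rotation_exp_def sin_add cos_add algebra_simps)
  finally show ?thesis .
qed

lemma rotation_exp_0 [simp]: "rotation_exp J 0 = mat 1"
  by (simp add: rotation_exp_def)

lemma continuous_rotation_exp: "continuous_on UNIV (rotation_exp J)"
  unfolding rotation_exp_def by (intro continuous_intros)

text \<open>The powers of \<open>A\<^sub>k\<close> follow the one-parameter group whose tangent vector \<open>J\<close> is the limit direction.
  One factor \<open>A\<^sub>k\<close> differs from the group element at time \<open>\<epsilon>\<^sub>k\<close> by \<open>o(\<epsilon>\<^sub>k)\<close>. About \<open>t / \<epsilon>\<^sub>k\<close>
  factors reach time \<open>t\<close>. Since all powers are uniformly bounded, the errors add up and are not
  amplified, so that the total error tends to \<open>0\<close>.\<close>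

lemma powers_tendsto_rotation_exp:
  fixes A :: "nat \<Rightarrow> real^4^4"
  assumes J: "J ** J ** J = - J"
    and pos: "\<And>k. \<epsilon> k > 0" and \<epsilon>: "\<epsilon> \<longlonglongrightarrow> 0"
    and tangent: "(\<lambda>k. (1 / \<epsilon> k) *\<^sub>R (A k - mat 1)) \<longlonglongrightarrow> J"
    and bdd: "\<And>k n::nat. norm (A k [^]\<^bsub>Lorentz\<^esub> n) \<le> R"
    and "t \<ge> 0"
  shows "(\<lambda>k. A k [^]\<^bsub>Lorentz\<^esub> nat \<lfloor>t / \<epsilon> k\<rfloor>) \<longlonglongrightarrow> rotation_exp J t"
proof -
  define E where "E = rotation_exp J"
  have Eadd: "E a ** E b = E (a + b)" for a b by (simp add: E_def rotation_exp_add J)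
  define Q where "Q = norm (mat 1 :: real^4^4) + norm J + 2 * norm (J ** J)"
  have EQ: "norm (E s) \<le> Q" for s
  proof -
    have "norm (E s) \<le> norm (mat 1 :: real^4^4) + \<bar>sin s\<bar> * norm J + \<bar>1 - cos s\<bar> * norm (J ** J)"
      unfolding E_def rotation_exp_def by (intro order_trans[OF norm_triangle_ineq] add_mono) auto
    also have "\<dots> \<le> norm (mat 1 :: real^4^4) + 1 * norm J + 2 * norm (J ** J)"
      using cos_ge_minus_one[of s] by (intro add_mono mult_right_mono order_refl) auto
    finally show ?thesis by (simp add: Q_def)
  qed
  obtain c where "c > 0" and c: "\<And>(A::real^4^4) (B::real^4^4). norm (A ** B) \<le> norm A * norm B * c"
    using bounded_bilinear.pos_bounded[OF bounded_bilinear_matrix_mult] by metis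
  have "R \<ge> 0" using bdd[of 0 0] norm_ge_zero order_trans by blast
  define C where "C = R * Q * c\<^sup>2"
  define D where "D k = norm (A k - E (\<epsilon> k))" for k
  \<comment> \<open>The error of \<open>n + 1\<close> factors is that of the last factor plus that of the first \<open>n\<close>, moved on by
    \<open>E (\<epsilon> k)\<close>; the free factor \<open>E s\<close> absorbs this motion.\<close>
  have step: "norm ((A k [^]\<^bsub>Lorentz\<^esub> n - E (real n * \<epsilon> k)) ** E s) \<le> real n * (C * D k)" for n k s
  proof (induction n arbitrary: s)
    case 0
    then show ?case by (simp add: E_def)
  next
    case (Suc n)
    let ?P = "A k [^]\<^bsub>Lorentz\<^esub> n"
    have "(A k [^]\<^bsub>Lorentz\<^esub> Suc n - E (real (Suc n) * \<epsilon> k)) ** E s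
        = (?P ** (A k - E (\<epsilon> k))) ** E s + (?P - E (real n * \<epsilon> k)) ** E (\<epsilon> k + s)"
      by (simp add: matrix_mult_diff Eadd algebra_simps flip: matrix_mul_assoc)
    also have "norm \<dots> \<le> norm ((?P ** (A k - E (\<epsilon> k))) ** E s)
        + norm ((?P - E (real n * \<epsilon> k)) ** E (\<epsilon> k + s))"
      by (rule norm_triangle_ineq)
    also have "norm ((?P ** (A k - E (\<epsilon> k))) ** E s) \<le> (norm ?P * D k * c) * norm (E s) * c"
      using c[of "?P ** (A k - E (\<epsilon> k))" "E s"] c[of ?P "A k - E (\<epsilon> k)"] \<open>c > 0\<close>
      unfolding D_def by (meson less_imp_le mult_right_mono norm_ge_zero order_trans)
    also have "\<dots> \<le> (R * D k * c) * Q * c"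
      using bdd[of k n] EQ[of s] \<open>c > 0\<close> \<open>R \<ge> 0\<close>
      by (intro mult_right_mono mult_mono) (auto simp: D_def)
    also have "(R * D k * c) * Q * c = C * D k" by (simp add: C_def power2_eq_square)
    finally show ?case using Suc[of "\<epsilon> k + s"] by (simp add: algebra_simps)
  qed
  have at0: "filterlim \<epsilon> (at 0) sequentially"
    using \<epsilon> pos by (auto simp: filterlim_at less_imp_neq[THEN not_sym])
  have "((\<lambda>x. sin x / x) \<longlongrightarrow> (1::real)) (at 0)"
    using DERIV_sin[of "0::real"] by (simp add: has_field_derivative_iff)
  from filterlim_compose[OF this at0] have sin: "(\<lambda>k. sin (\<epsilon> k) / \<epsilon> k) \<longlonglongrightarrow> 1" .
  have "((\<lambda>x. (cos x - 1) / x) \<longlongrightarrow> (0::real)) (at 0)"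
    using DERIV_cos[of "0::real"] by (simp add: has_field_derivative_iff)
  from filterlim_compose[OF this at0] have cos: "(\<lambda>k. (cos (\<epsilon> k) - 1) / \<epsilon> k) \<longlonglongrightarrow> 0" .
  have "(\<lambda>k. (1 / \<epsilon> k) *\<^sub>R (A k - mat 1) - (sin (\<epsilon> k) / \<epsilon> k) *\<^sub>R J
      + ((cos (\<epsilon> k) - 1) / \<epsilon> k) *\<^sub>R (J ** J)) \<longlonglongrightarrow> J - 1 *\<^sub>R J + 0 *\<^sub>R (J ** J)"
    by (intro tendsto_intros tangent sin cos)
  also have "(\<lambda>k. (1 / \<epsilon> k) *\<^sub>R (A k - mat 1) - (sin (\<epsilon> k) / \<epsilon> k) *\<^sub>R J
      + ((cos (\<epsilon> k) - 1) / \<epsilon> k) *\<^sub>R (J ** J)) = (\<lambda>k. (1 / \<epsilon> k) *\<^sub>R (A k - E (\<epsilon> k)))"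
    by (simp add: E_def rotation_exp_def algebra_simps diff_divide_distrib)
  finally have "(\<lambda>k. norm ((1 / \<epsilon> k) *\<^sub>R (A k - E (\<epsilon> k)))) \<longlonglongrightarrow> 0"
    by (intro tendsto_norm_zero) simp
  then have D0: "(\<lambda>k. D k / \<epsilon> k) \<longlonglongrightarrow> 0"
    by (simp add: D_def abs_of_pos[OF pos])
  define m where "m k = nat \<lfloor>t / \<epsilon> k\<rfloor>" for k
  have m: "(\<lambda>k. real (m k) * \<epsilon> k) \<longlonglongrightarrow> t"
  proof (rule tendsto_sandwich)
    have *: "t / \<epsilon> k - 1 \<le> real (m k)" "real (m k) \<le> t / \<epsilon> k" for k
      using \<open>t \<ge> 0\<close> pos[of k] by (simp_all add: m_def)
    show "\<forall>\<^sub>F k in sequentially. t - \<epsilon> k \<le> real (m k) * \<epsilon> k"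
      using *(1) pos by (simp add: field_simps)
    show "\<forall>\<^sub>F k in sequentially. real (m k) * \<epsilon> k \<le> t"
      using *(2) pos by (simp add: field_simps)
    show "(\<lambda>k. t - \<epsilon> k) \<longlonglongrightarrow> t" using tendsto_diff[OF tendsto_const \<epsilon>] by simp
  qed simp
  have "(\<lambda>k. A k [^]\<^bsub>Lorentz\<^esub> m k - E (real (m k) * \<epsilon> k)) \<longlonglongrightarrow> 0"
  proof (rule Lim_null_comparison)
    show "\<forall>\<^sub>F k in sequentially. norm (A k [^]\<^bsub>Lorentz\<^esub> m k - E (real (m k) * \<epsilon> k))
        \<le> (real (m k) * \<epsilon> k) * C * (D k / \<epsilon> k)"
      using step[of _ "m _" 0] pos by (simp add: E_def less_imp_neq[THEN not_sym] mult.assoc)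
    have "(\<lambda>k. (real (m k) * \<epsilon> k) * C * (D k / \<epsilon> k)) \<longlonglongrightarrow> t * C * 0"
      by (intro tendsto_intros m D0)
    then show "(\<lambda>k. (real (m k) * \<epsilon> k) * C * (D k / \<epsilon> k)) \<longlonglongrightarrow> 0" by simp
  qed
  moreover have "(\<lambda>k. E (real (m k) * \<epsilon> k)) \<longlonglongrightarrow> E t"
    using continuous_on_tendsto_compose[OF continuous_rotation_exp m] by (simp add: E_def)
  ultimately show ?thesis
    using tendsto_add[of _ 0 _ _ "E t"] unfolding E_def m_def by fastforce
qed

section \<open>Closed subgroups contain discrete subgroups\<close>

text \<open>The half-turn about the limit direction \<open>J\<close> of the powers that tend to \<open>1\<close>. It differs from \<open>1\<close>
  by \<open>2 J\<^sup>2\<close>, and \<open>J\<^sup>2 = 0\<close> would give \<open>J = - J\<^sup>3 = 0\<close>.\<close>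

lemma nondiscrete_cyclic_closure_involution:
  assumes h: "h \<in> carrier Lorentz" and nd: "\<not> discrete (generate Lorentz {h})"
  obtains T where "T \<in> closure (range (\<lambda>n::nat. h [^]\<^bsub>Lorentz\<^esub> n))" "T \<noteq> mat 1" "T ** T = mat 1"
proof -
  define P where "P n = h [^]\<^bsub>Lorentz\<^esub> (n::nat)" for n
  have PL: "P n \<in> carrier Lorentz" for n using h by (simp add: P_def)
  have bdd: "bounded (range P)" unfolding P_def
    using nondiscrete_cyclic_recurrent[OF h nd] by (intro recurrent_powers_bounded[OF h]) metis
  obtain v where hv: "h *v v = v" and v: "(v $ 1)\<^sup>2 + (v $ 2)\<^sup>2 + (v $ 3)\<^sup>2 < (v $ 0)\<^sup>2"
    using bounded_powers_fix_timelike[OF h] bdd unfolding P_def by blast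
  have Pv: "P n *v v = v" for n
    by (induction n) (simp_all add: P_def hv flip: matrix_vector_mul_assoc)
  have "\<exists>n. P n \<noteq> mat 1 \<and> norm (P n - mat 1) < 1 / real (Suc k)" for k
    using nondiscrete_cyclic_recurrent[OF h nd, of "1 / real (Suc k)" 0] unfolding P_def by auto
  then obtain n where n1: "\<And>k. P (n k) \<noteq> mat 1" and n2: "\<And>k. norm (P (n k) - mat 1) < 1 / real (Suc k)"
    by metis
  define d where "d k = norm (P (n k) - mat 1)" for k
  define Y where "Y k = (1 / d k) *\<^sub>R (P (n k) - mat 1)" for k
  have d: "d k > 0" for k using n1 by (simp add: d_def)
  have d0: "d \<longlonglongrightarrow> 0"
  proof (rule Lim_null_comparison)
    show "\<forall>\<^sub>F k in sequentially. norm (d k) \<le> 1 / real (Suc k)"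
      using n2 by (simp add: d_def less_imp_le)
  qed (rule lim_1_over_n[THEN LIMSEQ_Suc])
  have Y1: "norm (Y k) = 1" for k using d[of k] by (simp add: Y_def) (simp add: d_def)
  then have "\<forall>k. Y k \<in> sphere 0 1" by simp
  then obtain X r where X1: "X \<in> sphere 0 1" and r: "strict_mono r" and lim: "(Y \<circ> r) \<longlonglongrightarrow> X"
    using compact_sphere[of "0::real^4^4" 1] unfolding compact_def by blast
  define e where "e k = d (r k)" for k
  define Z where "Z k = Y (r k)" for k
  have Z: "Z \<longlonglongrightarrow> X" using lim by (simp add: Z_def[abs_def] comp_def)
  have e: "e k > 0" for k using d by (simp add: e_def)
  have e0: "e \<longlonglongrightarrow> 0" using LIMSEQ_subseq_LIMSEQ[OF d0 r] by (simp add: e_def[abs_def] comp_def)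
  have PZ: "P (n (r k)) = mat 1 + e k *\<^sub>R Z k" for k
    using e[of k] by (simp add: Z_def Y_def flip: e_def)
  have "X *v v = 0"
  proof -
    have "Z k *v v = 0" for k
    proof -
      have "v + e k *\<^sub>R (Z k *v v) = v"
        using Pv[of "n (r k)"] unfolding PZ
        by (simp only: matrix_vector_mult_add_rdistrib scaleR_matrix_vector_assoc[symmetric]
            matrix_vector_mul_lid)
      then show ?thesis using e[of k] by simp
    qed
    moreover have bl: "bounded_linear (\<lambda>A::real^4^4. A *v v)"
      unfolding linear_conv_bounded_linear[symmetric]
      by (intro linearI) (simp_all add: matrix_vector_mult_add_rdistrib scaleR_matrix_vector_assoc)
    ultimately show ?thesis
      using bounded_linear.tendsto[OF bl Z] by (simp add: LIMSEQ_const_iff)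
  qed
  moreover have "lorentz_adjoint X = - X"
  proof -
    \<comment> \<open>This is the equation \<open>(1 + e Z)\<^sup>* (1 + e Z) = 1\<close> divided by \<open>e\<close>.\<close>
    have "lorentz_adjoint (Z k) + Z k + e k *\<^sub>R (lorentz_adjoint (Z k) ** Z k) = 0" for k
    proof -
      have "lorentz_adjoint (P (n (r k))) ** P (n (r k)) = mat 1"
        using full_lorentz_adjoint PL lorentz_subset by blast
      moreover have "lorentz_adjoint (P (n (r k))) = mat 1 + e k *\<^sub>R lorentz_adjoint (Z k)"
        by (simp add: PZ vec_eq_iff lorentz_adjoint_entry mat_def)
      ultimately have "e k *\<^sub>R (lorentz_adjoint (Z k) + Z k + e k *\<^sub>R (lorentz_adjoint (Z k) ** Z k)) = 0"
        by (simp add: PZ matrix_mult_add matrix_mult_scaleR algebra_simps)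
      then show ?thesis using e[of k] by simp
    qed
    moreover have "(\<lambda>k. lorentz_adjoint (Z k) + Z k + e k *\<^sub>R (lorentz_adjoint (Z k) ** Z k))
        \<longlonglongrightarrow> lorentz_adjoint X + X + 0 *\<^sub>R (lorentz_adjoint X ** X)"
      unfolding lorentz_adjoint_def by (intro tendsto_intros Z e0)
    ultimately show ?thesis by (simp add: LIMSEQ_const_iff eq_neg_iff_add_eq_0)
  qed
  moreover have "X \<noteq> 0" using X1 by auto
  ultimately obtain \<omega> where \<omega>: "\<omega> > 0" "X ** X ** X = - (\<omega>\<^sup>2) *\<^sub>R X"
    using skew_fixing_timelike_cube v by metis
  define J where "J = (1 / \<omega>) *\<^sub>R X"
  have J: "J ** J ** J = - J"
    using \<omega> by (simp add: J_def matrix_mult_scaleR power2_eq_square)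
  have J0: "J \<noteq> 0" using \<omega> \<open>X \<noteq> 0\<close> by (simp add: J_def)
  obtain R where R: "\<And>k. norm (P k) \<le> R" using bdd by (auto simp: bounded_iff)
  define A where "A k = P (n (r k))" for k
  have Apow: "A k [^]\<^bsub>Lorentz\<^esub> j = P (n (r k) * j)" for k j :: nat
    using Lorentz.nat_pow_pow[OF h] by (simp add: A_def P_def)
  have "(\<lambda>k. A k [^]\<^bsub>Lorentz\<^esub> nat \<lfloor>pi / (\<omega> * e k)\<rfloor>) \<longlonglongrightarrow> rotation_exp J pi"
  proof (rule powers_tendsto_rotation_exp[OF J])
    show "(\<lambda>k. \<omega> * e k) \<longlonglongrightarrow> 0" using tendsto_mult_right_zero[OF e0] by simp
    have "(1 / (\<omega> * e k)) *\<^sub>R (A k - mat 1) = (1 / \<omega>) *\<^sub>R Z k" for k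
      using e[of k] by (simp add: A_def PZ)
    then show "(\<lambda>k. (1 / (\<omega> * e k)) *\<^sub>R (A k - mat 1)) \<longlonglongrightarrow> J"
      unfolding J_def by (simp only:) (intro tendsto_intros Z)
    show "norm (A k [^]\<^bsub>Lorentz\<^esub> j) \<le> R" for k and j :: nat by (simp add: Apow R)
  qed (use \<omega> e in auto)
  then have "rotation_exp J pi \<in> closure (range P)"
    unfolding closure_sequential Apow
    by (intro exI[of _ "\<lambda>k. P (n (r k) * nat \<lfloor>pi / (\<omega> * e k)\<rfloor>)"]) simp
  moreover have "rotation_exp J pi ** rotation_exp J pi = mat 1"
    using rotation_exp_add[OF J, of pi pi] by (simp add: rotation_exp_def)
  moreover have "rotation_exp J pi \<noteq> mat 1"
  proof
    assume "rotation_exp J pi = mat 1"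
    then have "J ** J = 0" by (simp add: rotation_exp_def)
    then have "J ** J ** J = 0" by (simp add: bounded_bilinear.zero_left[OF bounded_bilinear_matrix_mult])
    with J J0 show False by simp
  qed
  ultimately show ?thesis using that unfolding P_def by blast
qed

text \<open>A closed subgroup contains the closure of the powers of each of its elements, hence the half-turn
  found there if the powers do not form a discrete group.\<close>

lemma closed_subgroup_contains_discrete:
  assumes H: "subgroup H Lorentz" and "closed H" and "H \<noteq> {mat 1}"
  obtains K where "subgroup K Lorentz" "discrete K" "K \<noteq> {mat 1}" "K \<subseteq> H"
proof -
  have one: "mat 1 \<in> H" using subgroup.one_closed[OF H] by simp
  with \<open>H \<noteq> {mat 1}\<close> obtain h where h: "h \<in> H" "h \<noteq> mat 1" by blast
  then have hL: "h \<in> carrier Lorentz" using subgroup.mem_carrier[OF H] by blast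
  show ?thesis
  proof (cases "discrete (generate Lorentz {h})")
    case True
    show ?thesis
    proof (rule that[OF _ True])
      show "subgroup (generate Lorentz {h}) Lorentz"
        using hL by (intro Lorentz.generate_is_subgroup) auto
      show "generate Lorentz {h} \<noteq> {mat 1}" using generate.incl[of h "{h}" Lorentz] h by auto
      show "generate Lorentz {h} \<subseteq> H" using Lorentz.generate_subgroup_incl[OF _ H] h by blast
    qed
  next
    case False
    then obtain T where Tcl: "T \<in> closure (range (\<lambda>n::nat. h [^]\<^bsub>Lorentz\<^esub> n))"
      and T: "T \<noteq> mat 1" "T ** T = mat 1"
      using nondiscrete_cyclic_closure_involution[OF hL] by blast
    have "h [^]\<^bsub>Lorentz\<^esub> n \<in> H" for n :: nat
      using subgroup.m_closed[OF H] h one by (induction n) auto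
    then have "closure (range (\<lambda>n::nat. h [^]\<^bsub>Lorentz\<^esub> n)) \<subseteq> H"
      using \<open>closed H\<close> by (intro closure_minimal) auto
    with Tcl have "T \<in> H" by blast
    then have TL: "T \<in> carrier Lorentz" using subgroup.mem_carrier[OF H] by blast
    have "inv\<^bsub>Lorentz\<^esub> T = T" using T TL by (intro Lorentz.inv_equality) auto
    then have "subgroup {mat 1, T} Lorentz"
      using T TL lorentz_one Lorentz.inv_one by (intro Lorentz.subgroupI) auto
    moreover have "discrete {mat 1, T}" by (auto simp: discrete_def isolated_in_islimpt_iff islimpt_finite)
    ultimately show ?thesis using that[of "{mat 1, T}"] T \<open>T \<in> H\<close> one by auto
  qed
qed

section \<open>Subgroups that are not closed\<close>

text \<open>Being closed near \<open>1\<close> suffices, since translations by elements of \<open>H\<close> move any limit point of \<open>H\<close>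
  near \<open>1\<close>.\<close>

lemma locally_closed_subgroup_closed:
  assumes H: "subgroup H Lorentz" and U: "open U" "mat 1 \<in> U" and cl: "closedin (top_of_set U) (H \<inter> U)"
  shows "closed H"
proof -
  have HL: "H \<subseteq> carrier Lorentz" using H by (rule subgroup.subset)
  have "x \<in> H" if x: "x \<in> closure H" for x
  proof -
    have "x \<in> carrier Lorentz" using x closure_minimal[OF HL closed_Lorentz] by blast
    then have inv: "lorentz_adjoint x ** x = mat 1" using full_lorentz_adjoint lorentz_subset by blast
    have adj: "continuous_on UNIV lorentz_adjoint"
      unfolding lorentz_adjoint_def by (intro continuous_intros)
    \<comment> \<open>\<open>y\<inverse> x\<close> is near \<open>1\<close> for \<open>y \<in> H\<close> near \<open>x\<close>, and it lies in \<open>closure H\<close>; there the local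
      hypothesis decides membership.\<close>
    have "open {y. lorentz_adjoint y ** x \<in> U}"
      using open_vimage[OF U(1), of "\<lambda>y. lorentz_adjoint y ** x"] adj
      by (simp add: vimage_def continuous_intros)
    moreover have "x \<in> {y. lorentz_adjoint y ** x \<in> U}" using U inv by simp
    ultimately have "{y. lorentz_adjoint y ** x \<in> U} \<inter> H \<noteq> {}"
      using x open_Int_closure_eq_empty by blast
    then obtain y where y: "y \<in> H" "lorentz_adjoint y ** x \<in> U" by blast
    define u where "u = lorentz_adjoint y ** x"
    have yL: "y \<in> carrier Lorentz" using y HL by blast
    then have yadj: "lorentz_adjoint y \<in> H" using y H inv_Lorentz subgroup.m_inv_closed by metis
    have "u \<in> closure H"
    proof -
      have "bounded_linear ((**) (lorentz_adjoint y))"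
        by (rule bounded_bilinear.bounded_linear_right[OF bounded_bilinear_matrix_mult])
      then have "u \<in> closure ((**) (lorentz_adjoint y) ` H)"
        using x closure_bounded_linear_image_subset[of "(**) (lorentz_adjoint y)" H] imageI[of x "closure H"]
        unfolding u_def by blast
      also have "\<dots> \<subseteq> closure H"
        by (intro closure_mono image_subsetI) (use subgroup.m_closed[OF H yadj] in simp)
      finally show ?thesis .
    qed
    moreover have "u \<in> U" using y by (simp add: u_def)
    ultimately have "u \<in> closure (H \<inter> U)"
      using open_Int_closure_subset[OF U(1), of H] by (auto simp: Int_commute)
    moreover obtain C where C: "closed C" "H \<inter> U = U \<inter> C" using cl by (auto simp: closedin_closed)
    ultimately have "u \<in> C" using closure_minimal[of "H \<inter> U" C] by blast
    then have "u \<in> H" using C \<open>u \<in> U\<close> by blast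
    then have "y ** u \<in> H" using subgroup.m_closed[OF H, of y u] y by simp
    moreover have "y ** u = x"
      using yL full_lorentz_adjoint(2)[of y] lorentz_subset by (auto simp: u_def matrix_mul_assoc)
    ultimately show ?thesis by simp
  qed
  then show ?thesis by (metis closure_subset closed_closure subsetI subset_antisym)
qed

text \<open>In a slice chart a submanifold is a piece of a linear subspace, so it is locally closed.\<close>

lemma lie_subgroup_closed:
  assumes "lie_subgroup H Lorentz"
  shows "closed H"
proof -
  have H: "subgroup H Lorentz" and "embedded_submanifold H" using assms by (auto simp: lie_subgroup_def)
  moreover have one: "mat 1 \<in> H" using subgroup.one_closed[OF H] by simp
  ultimately obtain U V and f g :: "real^4^4 \<Rightarrow> real^4^4" and T where
    U: "open U" "mat 1 \<in> U" and hom: "homeomorphism U V f g" and T: "subspace T"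
    and flat: "f ` (H \<inter> U) = T \<inter> V"
    unfolding embedded_submanifold_def by metis
  have "H \<inter> U = U \<inter> f -` T"
  proof (intro equalityI subsetI)
    fix u assume u: "u \<in> U \<inter> f -` T"
    then have "f u \<in> f ` (H \<inter> U)" using flat hom by (auto simp: homeomorphism_def)
    then obtain u' where "u' \<in> H \<inter> U" "f u = f u'" by blast
    then show "u \<in> H \<inter> U" using u hom by (metis IntE homeomorphism_apply1)
  qed (use flat in blast)
  moreover have "closedin (top_of_set U) (U \<inter> f -` T)"
    using hom T by (intro continuous_closedin_preimage closed_subspace) (auto simp: homeomorphism_def)
  ultimately show ?thesis using locally_closed_subgroup_closed[OF H U] by simp
qed

text \<open>The subgroup is the preimage of a point of the coset space under the projection.\<close>

lemma Hausdorff_coset_space_closed: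
  assumes H: "subgroup H Lorentz" and "Hausdorff_space (coset_topology Lorentz H)"
  shows "closed H"
proof -
  let ?L = "top_of_set (carrier Lorentz)"
  have "H \<in> topspace (coset_topology Lorentz H)"
    using Lorentz.lcos_mult_one[OF subgroup.subset[OF H]] lorentz_one
    by (force simp: topspace_coset_topology LCOSETS_def)
  then have "closedin (coset_topology Lorentz H) {H}"
    using assms(2) by (simp add: Hausdorff_imp_t1_space closedin_t1_singleton)
  moreover have "continuous_map ?L (coset_topology Lorentz H) (\<lambda>g. g <#\<^bsub>Lorentz\<^esub> H)"
    unfolding coset_topology_def
    by (rule quotient_imp_continuous_map[OF quotient_map_quotient_topology])
  ultimately have "closedin ?L {g \<in> topspace ?L. g <#\<^bsub>Lorentz\<^esub> H \<in> {H}}"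
    by (rule closedin_continuous_map_preimage[rotated])
  moreover have "{g \<in> topspace ?L. g <#\<^bsub>Lorentz\<^esub> H \<in> {H}} = H"
  proof (intro equalityI subsetI)
    fix g assume "g \<in> {g \<in> topspace ?L. g <#\<^bsub>Lorentz\<^esub> H \<in> {H}}"
    then show "g \<in> H" using Lorentz.lcos_self[OF _ H, of g] by auto
  next
    fix g assume g: "g \<in> H"
    then have gL: "g \<in> carrier Lorentz" using subgroup.mem_carrier[OF H] by blast
    have "x \<in> g <#\<^bsub>Lorentz\<^esub> H" if "x \<in> H" for x
    proof -
      have "inv\<^bsub>Lorentz\<^esub> g \<otimes>\<^bsub>Lorentz\<^esub> x \<in> H"
        using that g subgroup.m_closed[OF H] subgroup.m_inv_closed[OF H] by blast
      moreover have "x = g \<otimes>\<^bsub>Lorentz\<^esub> (inv\<^bsub>Lorentz\<^esub> g \<otimes>\<^bsub>Lorentz\<^esub> x)"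
        using Lorentz.inv_solve_left' gL that subgroup.mem_carrier[OF H]
        by (metis Lorentz.inv_closed Lorentz.l_one Lorentz.m_assoc Lorentz.r_inv)
      ultimately show ?thesis unfolding l_coset_def by blast
    qed
    moreover have "g <#\<^bsub>Lorentz\<^esub> H \<subseteq> H"
      using subgroup.m_closed[OF H] g unfolding l_coset_def by blast
    ultimately show "g \<in> {g \<in> topspace ?L. g <#\<^bsub>Lorentz\<^esub> H \<in> {H}}" using gL by auto
  qed
  ultimately show ?thesis using closed_Lorentz closedin_closed_trans by metis
qed

lemma Ck_on_const: "Ck_on n S (\<lambda>x. c)"
  by (induction n arbitrary: c) auto

lemma smooth_on_translate: "smooth_on S (\<lambda>x. x + c)"
proof -
  have "frechet_derivative (\<lambda>x. x + c) (at x) = (\<lambda>v. v)" for x :: 'a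
    by (rule frechet_derivative_at[symmetric]) (auto intro!: derivative_eq_intros)
  then have "Ck_on n S (\<lambda>x. x + c)" for n
    by (cases n) (auto intro!: continuous_intros simp: Ck_on_const)
  then show ?thesis by (simp add: smooth_on_def)
qed

lemma embedded_submanifold_singleton: "embedded_submanifold {a :: 'a::euclidean_space}"
proof -
  have "homeomorphism UNIV UNIV (\<lambda>x. x + (- a)) (\<lambda>x. x + a)"
    by (auto simp: homeomorphism_def image_iff intro!: continuous_intros exI[of _ "_ + a"] exI[of _ "_ - a"])
  moreover have "(\<lambda>x. x + (- a)) ` ({a} \<inter> UNIV) = {0} \<inter> UNIV" by simp
  moreover have "dim {0 :: 'a} = 0" by simp
  ultimately show ?thesis
    unfolding embedded_submanifold_def
    using smooth_on_translate[of UNIV] open_UNIV subspace_single_0 UNIV_I by metis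
qed

section \<open>The four cases\<close>

theorem proposition3p2:
  fixes M :: "'x measure"
    and \<phi> :: "real^4^4 \<Rightarrow> 'x \<Rightarrow> 'x"
    and \<pi> :: "'x \<Rightarrow> real^4"
    and m :: 'x
    and Orb :: "(real^4) set"
    and H G :: "(real^4^4) set"
  assumes "Orb \<in> orbits Lorentz UNIV mink_action"
    and "irreducible_object M \<phi> \<pi>"
    and "\<pi> ` space M = Orb"
    and "m \<in> space M"
    and "H = stabilizer Lorentz \<phi> m"
    and "G = stabilizer Lorentz mink_action (\<pi> m)"
  shows "H \<subseteq> G \<and>
    (H = G
     \<or> (lie_subgroup H (Lorentz\<lparr>carrier := G\<rparr>) \<and> connected H)
     \<or> (\<exists>K. subgroup K (Lorentz\<lparr>carrier := G\<rparr>) \<and> discrete K \<and> K \<noteq> {\<one>\<^bsub>Lorentz\<^esub>} \<and> K \<subseteq> H)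
     \<or> (subgroup H Lorentz \<and> \<not> lie_subgroup H Lorentz
         \<and> \<not> Hausdorff_space (coset_topology Lorentz H)))"
proof -
  have rep: "rep_object M \<phi> \<pi>" using assms(2) by (simp add: irreducible_object_def)
  have H: "subgroup H Lorentz"
    unfolding assms(5) using rep assms(4)
    by (intro group_action.stabilizer_subgroup) (auto simp: rep_object_def)
  have G: "subgroup G Lorentz"
    unfolding assms(6) by (rule group_action.stabilizer_subgroup[OF group_action_mink_action]) simp
  have HG: "H \<subseteq> G"
  proof
    fix g assume "g \<in> H"
    then have "g \<in> carrier Lorentz" "\<phi> g m = m" by (auto simp: assms(5) stabilizer_def)
    then show "g \<in> G" using rep assms(4) by (force simp: assms(6) stabilizer_def rep_object_def)
  qed
  show ?thesis
  proof (cases "closed H")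
    case False
    then show ?thesis using HG H lie_subgroup_closed Hausdorff_coset_space_closed by blast
  next
    case closed: True
    show ?thesis
    proof (cases "H = {mat 1}")
      case True
      have "lie_subgroup H (Lorentz\<lparr>carrier := G\<rparr>)"
        using Lorentz.subgroup_incl[OF H G HG] embedded_submanifold_singleton
        by (simp add: lie_subgroup_def True)
      then show ?thesis using HG True by simp
    next
      case False
      then obtain K where K: "subgroup K Lorentz" "discrete K" "K \<noteq> {mat 1}" "K \<subseteq> H"
        using closed_subgroup_contains_discrete[OF H closed] by blast
      then have "subgroup K (Lorentz\<lparr>carrier := G\<rparr>)" using Lorentz.subgroup_incl G HG by blast
      then show ?thesis using HG K by auto
    qed
  qed
qed

end
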